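(* Let $M,N,S$ be positive integers, and let $Q$ denote the I/O complexity (minimum number of Load moves over all complete red-white pebble games with $S$ red pebbles) of the CDAG of the Modified Gram-Schmidt program below applied to an $M\times N$ matrix $A$. Then $$\frac{M^2N(N-1)}{8(S+M)} \leq Q .$$ Furthermore, if $S\leq M$, then also $$\frac{(M-S)N(N-1)}{4}\leq Q .$$
   Context: Program (Modified Gram-Schmidt, right-looking), with input $M\times N$ array $A$, output arrays $Q$ ($M\times N$) and $R$ ($N\times N$), and scalar $nrm$: for k = 0,...,N-1: nrm = 0.0 for i = 0,...,M-1: nrm += A[i][k]*A[i][k] R[k][k] = sqrt(nrm) for i = 0,...,M-1: Q[i][k] = A[i][k] / R[k][k] for j = k+1,...,N-1: R[k][j] = 0.0 for i = 0,...,M-1: R[k][j] += Q[i][k]*A[i][j] for i = 0,...,M-1: A[i][j] = A[i][j] - Q[i][k]*R[k][j] CDAG of a program: a directed acyclic graph whose nodes are the input values (initial values of array entries read before being written) and the statement instances (each execution of an assignment statement, including compound assignments such as +=), with an edge $u\to v$ whenever the instance $v$ reads a value produced by $u$ (flow dependence). Input nodes have no incoming edges. Red-white pebble game with $S$ red pebbles on a CDAG: initially only the input nodes carry white pebbles and there are no red pebbles. Allowed moves: (Spill) remove a red pebble from a node; (Compute) if a node has no white pebble and all its predecessors carry red pebbles, place a white and a red pebble on it; (Load) place a red pebble on a node carrying a white pebble. At no time may more than $S$ red pebbles be on the graph. The game is complete when every node carries a white pebble. (White pebbles are never removed, so no recomputation.) The I/O complexity $Q$ is the minimum, over all complete games,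 of the number of Load moves. *)

theory Defs
  imports "HOL-Library.Extended_Real"
begin

section \<open>CDAG of a program, from its execution trace\<close>

record 'v cdag =
  nodes :: "'v set"
  inputs :: "'v set"
  edges :: "('v \<times> 'v) set"

datatype ('c, 's) node = Input 'c | Inst 's

text \<open>
  A (straight-line unrolled) program execution is given by the list \<open>tr\<close> of its statement
  instances in execution order, the memory cells \<open>rd s\<close> read and the memory cell \<open>wr s\<close> written by
  an instance \<open>s\<close>. An instance reads before it writes, so \<open>x += e\<close> reads the previous value of \<open>x\<close>.
  Instances serve as nodes, so the entries of \<open>tr\<close> have to be distinct.
\<close>

definition earlier_writes :: "('s \<Rightarrow> 'c) \<Rightarrow> 's list \<Rightarrow> nat \<Rightarrow> 'c \<Rightarrow> nat set" where
  "earlier_writes wr tr p c = {q. q < p \<and> wr (tr ! q) = c}"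

text \<open>The node producing the value held by cell \<open>c\<close> just before step \<open>p\<close>: the last write to \<open>c\<close>,
  or the initial content of \<open>c\<close>.\<close>

definition producer :: "('s \<Rightarrow> 'c) \<Rightarrow> 's list \<Rightarrow> nat \<Rightarrow> 'c \<Rightarrow> ('c, 's) node" where
  "producer wr tr p c =
     (if earlier_writes wr tr p c = {} then Input c
      else Inst (tr ! Max (earlier_writes wr tr p c)))"

definition trace_inputs :: "('s \<Rightarrow> 'c set) \<Rightarrow> ('s \<Rightarrow> 'c) \<Rightarrow> 's list \<Rightarrow> ('c, 's) node set" where
  "trace_inputs rd wr tr =
     {Input c | c p. p < length tr \<and> c \<in> rd (tr ! p) \<and> earlier_writes wr tr p c = {}}"

definition trace_cdag :: "('s \<Rightarrow> 'c set) \<Rightarrow> ('s \<Rightarrow> 'c) \<Rightarrow> 's list \<Rightarrow> ('c, 's) node cdag" where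
  "trace_cdag rd wr tr =
     \<lparr> nodes = trace_inputs rd wr tr \<union> Inst ` set tr,
       inputs = trace_inputs rd wr tr,
       edges = {(producer wr tr p c, Inst (tr ! p)) | p c. p < length tr \<and> c \<in> rd (tr ! p)} \<rparr>"


section \<open>Red-white pebble game\<close>

datatype 'v move = Spill 'v | Compute 'v | Load 'v

text \<open>A configuration is the pair of the set of red and the set of white pebbled nodes.\<close>

inductive pebble_step ::
  "nat \<Rightarrow> 'v cdag \<Rightarrow> 'v set \<times> 'v set \<Rightarrow> 'v move \<Rightarrow> 'v set \<times> 'v set \<Rightarrow> bool"
  for S :: nat and G :: "'v cdag" where
  spill: "v \<in> red \<Longrightarrow> pebble_step S G (red, white) (Spill v) (red - {v}, white)"
| compute: "\<lbrakk>v \<in> nodes G; v \<notin> white; \<And>u. (u, v) \<in> edges G \<Longrightarrow> u \<in> red; card (insert v red) \<le> S\<rbrakk>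
    \<Longrightarrow> pebble_step S G (red, white) (Compute v) (insert v red, insert v white)"
| load: "\<lbrakk>v \<in> white; card (insert v red) \<le> S\<rbrakk>
    \<Longrightarrow> pebble_step S G (red, white) (Load v) (insert v red, white)"

inductive pebble_run ::
  "nat \<Rightarrow> 'v cdag \<Rightarrow> 'v set \<times> 'v set \<Rightarrow> 'v move list \<Rightarrow> 'v set \<times> 'v set \<Rightarrow> bool"
  for S :: nat and G :: "'v cdag" where
  run_Nil: "pebble_run S G c [] c"
| run_Cons: "\<lbrakk>pebble_step S G c m c'; pebble_run S G c' ms c''\<rbrakk> \<Longrightarrow> pebble_run S G c (m # ms) c''"

definition complete_game :: "nat \<Rightarrow> 'v cdag \<Rightarrow> 'v move list \<Rightarrow> bool" where
  "complete_game S G ms \<longleftrightarrow>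
     (\<exists>red white. pebble_run S G ({}, inputs G) ms (red, white) \<and> nodes G \<subseteq> white)"

definition loads :: "'v move list \<Rightarrow> nat" where
  "loads ms = length (filter (\<lambda>m. \<exists>v. m = Load v) ms)"

text \<open>The infimum is attained as soon as a complete game exists; it is \<open>\<infinity>\<close> if \<open>S\<close> is too small for
  any complete game.\<close>

definition io_complexity :: "nat \<Rightarrow> 'v cdag \<Rightarrow> enat" where
  "io_complexity S G = (INF ms \<in> {ms. complete_game S G ms}. enat (loads ms))"


section \<open>Modified Gram-Schmidt, right-looking\<close>

datatype mgs_cell = CellA nat nat | CellQ nat nat | CellR nat nat | CellNrm

datatype mgs_instance =
    NrmInit nat          (* nrm = 0.0 *)
  | NrmAcc nat nat       (* nrm += A[i][k]*A[i][k] *)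
  | RDiag nat            (* R[k][k] = sqrt(nrm) *)
  | QDiv nat nat         (* Q[i][k] = A[i][k] / R[k][k] *)
  | RInit nat nat        (* R[k][j] = 0.0 *)
  | RAcc nat nat nat     (* R[k][j] += Q[i][k]*A[i][j] *)
  | AUpd nat nat nat     (* A[i][j] = A[i][j] - Q[i][k]*R[k][j] *)

fun mgs_write :: "mgs_instance \<Rightarrow> mgs_cell" where
  "mgs_write (NrmInit k) = CellNrm"
| "mgs_write (NrmAcc k i) = CellNrm"
| "mgs_write (RDiag k) = CellR k k"
| "mgs_write (QDiv k i) = CellQ i k"
| "mgs_write (RInit k j) = CellR k j"
| "mgs_write (RAcc k j i) = CellR k j"
| "mgs_write (AUpd k j i) = CellA i j"

fun mgs_reads :: "mgs_instance \<Rightarrow> mgs_cell set" where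
  "mgs_reads (NrmInit k) = {}"
| "mgs_reads (NrmAcc k i) = {CellNrm, CellA i k}"
| "mgs_reads (RDiag k) = {CellNrm}"
| "mgs_reads (QDiv k i) = {CellA i k, CellR k k}"
| "mgs_reads (RInit k j) = {}"
| "mgs_reads (RAcc k j i) = {CellR k j, CellQ i k, CellA i j}"
| "mgs_reads (AUpd k j i) = {CellA i j, CellQ i k, CellR k j}"

definition mgs_trace :: "nat \<Rightarrow> nat \<Rightarrow> mgs_instance list" where
  "mgs_trace M N =
     concat (map (\<lambda>k.
         [NrmInit k]
       @ map (\<lambda>i. NrmAcc k i) [0..<M]
       @ [RDiag k]
       @ map (\<lambda>i. QDiv k i) [0..<M]
       @ concat (map (\<lambda>j.
             [RInit k j]
           @ map (\<lambda>i. RAcc k j i) [0..<M]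
           @ map (\<lambda>i. AUpd k j i) [0..<M]) [k+1..<N])) [0..<N])"

lemma distinct_mgs_trace: "distinct (mgs_trace M N)"
proof -
  have concat: "distinct (concat (map f xs))"
    if "distinct xs" "\<And>x. distinct (f x)" "\<And>x y. x \<noteq> y \<Longrightarrow> set (f x) \<inter> set (f y) = {}"
    for f :: "nat \<Rightarrow> mgs_instance list" and xs
    using that(1)
  proof (induction xs)
    case (Cons x xs)
    then have "set (f x) \<inter> set (f y) = {}" if "y \<in> set xs" for y
      using that \<open>\<And>x y. x \<noteq> y \<Longrightarrow> set (f x) \<inter> set (f y) = {}\<close>[of x y] by auto
    then show ?case
      using Cons \<open>\<And>x. distinct (f x)\<close> by auto
  qed simp
  have inner: "distinct (concat (map (\<lambda>j. [RInit k j] @ map (\<lambda>i. RAcc k j i) [0..<M]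
      @ map (\<lambda>i. AUpd k j i) [0..<M]) [k+1..<N]))" for k
    by (rule concat) (auto simp: distinct_map inj_on_def)
  show ?thesis
    unfolding mgs_trace_def
    by (rule concat, simp) (use inner in \<open>auto simp: distinct_map inj_on_def\<close>)
qed

definition mgs_cdag :: "nat \<Rightarrow> nat \<Rightarrow> (mgs_cell, mgs_instance) node cdag" where
  "mgs_cdag M N = trace_cdag mgs_reads mgs_write (mgs_trace M N)"

end

theory Submission
  imports Defs "HOL-Library.Product_Lexorder"
begin

text \<open>
  All updates \<open>AUpd k j _\<close> need \<open>R[k][j]\<close>, which in turn needs the whole column \<open>j\<close> of \<open>A\<close> as it
  was at the beginning of iteration \<open>k\<close>. When \<open>R[k][j]\<close> is about to be completed, this column has
  been computed and its \<open>M\<close> entries are all needed again, so at least \<open>M - S\<close> of them are loaded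
  at some point; summing over \<open>k < j\<close> gives the second bound.

  For the first bound, cut a game into segments of \<open>S\<close> loads. The values that a segment obtains from
  outside form a set \<open>D\<close> of at most \<open>2S\<close> nodes. Call a matrix position touched if the segment uses or
  computes a version of its entry; each touched position has a version in \<open>D\<close>. In each column \<open>j\<close>,
  the updates with the first and the last \<open>k\<close> number at most two per touched position. If
  \<open>(k, j)\<close> is strictly in between, then \<open>R[k][j]\<close> and \<open>R[k + 1][j]\<close> are both completed in the segment,
  so columns \<open>k\<close> and \<open>j\<close> are entirely touched. There are at most \<open>|D| / M\<close> such columns, hence at most
  \<open>2|D| + |D|\<^sup>2 / (2M)\<close> updates in a segment. The loss from the last, incomplete segment is
  absorbed by the fact that all \<open>M N\<close> inputs have to be loaded.
\<close>

section \<open>Flow dependences in a sorted trace\<close>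

text \<open>Keys increase strictly along the trace, so the \<open>Max\<close> over positions in
  \<open>producer\<close> becomes a condition on time stamps alone: no write to \<open>c\<close>
  between \<open>s\<close> and \<open>t\<close>.\<close>

lemma trace_cdag_edge_Inst:
  fixes key :: "'s \<Rightarrow> 'k::linorder"
  assumes sorted: "sorted_wrt (\<lambda>x y. key x < key y) tr"
    and mem: "s \<in> set tr" "t \<in> set tr" and less: "key s < key t"
    and cell: "wr s = c" "c \<in> rd t"
    and between: "\<And>u. \<lbrakk>u \<in> set tr; wr u = c; key s < key u; key u < key t\<rbrakk> \<Longrightarrow> False"
  shows "(Inst s, Inst t) \<in> edges (trace_cdag rd wr tr)"
proof -
  have mono: "key (tr ! a) < key (tr ! b)" if "a < b" "b < length tr" for a b
    using sorted that by (simp add: sorted_wrt_iff_nth_less)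
  obtain p q where p: "p < length tr" "tr ! p = t" and q: "q < length tr" "tr ! q = s"
    using mem by (metis in_set_conv_nth)
  have "q < p"
    using mono[of p q] p q less by (metis linorder_neqE_nat order_less_asym order_less_irrefl)
  have "earlier_writes wr tr p c \<subseteq> {..q}"
  proof
    fix a assume "a \<in> earlier_writes wr tr p c"
    then have a: "a < p" "wr (tr ! a) = c" by (auto simp: earlier_writes_def)
    show "a \<in> {..q}"
    proof (rule ccontr)
      assume "a \<notin> {..q}"
      then show False
        using between[of "tr ! a"] mono[of q a] mono[of a p] a p q by auto
    qed
  qed
  moreover have "q \<in> earlier_writes wr tr p c"
    using \<open>q < p\<close> q cell by (simp add: earlier_writes_def)
  ultimately have "producer wr tr p c = Inst s"
    using q Max_eqI[of "earlier_writes wr tr p c" q]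
    by (auto simp: producer_def intro: finite_subset)
  then show ?thesis
    unfolding trace_cdag_def using p cell by force
qed

lemma trace_cdag_edge_Input:
  fixes key :: "'s \<Rightarrow> 'k::linorder"
  assumes sorted: "sorted_wrt (\<lambda>x y. key x < key y) tr"
    and mem: "t \<in> set tr" and cell: "c \<in> rd t"
    and before: "\<And>u. \<lbrakk>u \<in> set tr; wr u = c; key u < key t\<rbrakk> \<Longrightarrow> False"
  shows "(Input c, Inst t) \<in> edges (trace_cdag rd wr tr)"
    and "Input c \<in> inputs (trace_cdag rd wr tr)"
proof -
  obtain p where p: "p < length tr" "tr ! p = t"
    using mem by (metis in_set_conv_nth)
  have "False" if "q < p" "wr (tr ! q) = c" for q
    using before[of "tr ! q"] sorted p that by (auto simp: sorted_wrt_iff_nth_less)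
  then have "earlier_writes wr tr p c = {}"
    by (auto simp: earlier_writes_def)
  then show "(Input c, Inst t) \<in> edges (trace_cdag rd wr tr)"
    and "Input c \<in> inputs (trace_cdag rd wr tr)"
    using p cell by (auto simp: trace_cdag_def trace_inputs_def producer_def intro!: exI[of _ p])
qed

lemma inputs_no_pred:
  "(u, v) \<in> edges (trace_cdag rd wr tr) \<Longrightarrow> v \<notin> inputs (trace_cdag rd wr tr)"
  by (auto simp: trace_cdag_def trace_inputs_def)

lemma Inst_notin_inputs: "Inst s \<notin> inputs (trace_cdag rd wr tr)"
  by (auto simp: trace_cdag_def trace_inputs_def)


section \<open>Runs of the pebble game\<close>

definition downclosed :: "'v cdag \<Rightarrow> 'v set \<Rightarrow> bool" where
  "downclosed G W \<longleftrightarrow> (\<forall>u v. (u, v) \<in> edges G \<longrightarrow> v \<in> W \<longrightarrow> u \<in> W)"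

lemma downclosedD: "downclosed G W \<Longrightarrow> (u, v) \<in> edges G \<Longrightarrow> v \<in> W \<Longrightarrow> u \<in> W"
  by (auto simp: downclosed_def)

text \<open>Invariant of the game. Runs may start in any such configuration, so that a game can be
  cut anywhere.\<close>

definition valid_config :: "nat \<Rightarrow> 'v cdag \<Rightarrow> 'v set \<times> 'v set \<Rightarrow> bool" where
  "valid_config S G c \<longleftrightarrow> finite (fst c) \<and> card (fst c) \<le> S \<and> fst c \<subseteq> snd c \<and>
     inputs G \<subseteq> snd c \<and> downclosed G (snd c)"

definition loaded :: "'v move list \<Rightarrow> 'v set" where
  "loaded ms = {v. Load v \<in> set ms}"

lemma loads_simps [simp]:
  "loads [] = 0"
  "loads (m # ms) = (if \<exists>v. m = Load v then 1 else 0) + loads ms"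
  "loads (ms @ ns) = loads ms + loads ns"
  by (auto simp: loads_def)

lemma loaded_simps [simp]:
  "loaded [] = {}"
  "loaded (Spill v # ms) = loaded ms"
  "loaded (Compute v # ms) = loaded ms"
  "loaded (Load v # ms) = insert v (loaded ms)"
  "loaded (ms @ ns) = loaded ms \<union> loaded ns"
  by (auto simp: loaded_def)

lemma finite_loaded: "finite (loaded ms)"
  and card_loaded_le: "card (loaded ms) \<le> loads ms"
proof -
  have "finite (loaded ms) \<and> card (loaded ms) \<le> loads ms"
  proof (induction ms)
    case (Cons m ms)
    then show ?case by (cases m) (auto simp: card_insert_if)
  qed simp
  then show "finite (loaded ms)" "card (loaded ms) \<le> loads ms" by auto
qed

lemma pebble_step_valid: "pebble_step S G c m c' \<Longrightarrow> valid_config S G c \<Longrightarrow> valid_config S G c'"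
proof (induction rule: pebble_step.induct)
  case (spill v red white)
  have "card (red - {v}) \<le> card red"
    by (rule card_Diff1_le)
  with spill show ?case by (auto simp: valid_config_def)
next
  case (compute v white red)
  then show ?case by (auto simp: valid_config_def downclosed_def)
next
  case (load v white red)
  then show ?case by (auto simp: valid_config_def)
qed

lemma pebble_run_valid: "pebble_run S G c ms c' \<Longrightarrow> valid_config S G c \<Longrightarrow> valid_config S G c'"
  by (induction rule: pebble_run.induct) (auto intro: pebble_step_valid)

lemma pebble_step_mono: "pebble_step S G c m c' \<Longrightarrow> snd c \<subseteq> snd c'"
  by (induction rule: pebble_step.induct) auto

lemma pebble_run_mono: "pebble_run S G c ms c' \<Longrightarrow> snd c \<subseteq> snd c'"
  by (induction rule: pebble_run.induct) (auto dest: pebble_step_mono)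

text \<open>When \<open>v\<close> is computed, \<open>u\<close> is red; it was red at the start, or
  was loaded, or was computed during the run.\<close>

lemma pebble_run_pred:
  assumes "pebble_run S G c ms c'" "(u, v) \<in> edges G" "v \<in> snd c'" "v \<notin> snd c"
  shows "u \<in> fst c \<union> loaded ms \<union> (snd c' - snd c)"
  using assms
proof (induction rule: pebble_run.induct)
  case (run_Cons c m c' ms c'')
  note mono = pebble_run_mono[OF run_Cons.hyps(2)]
  show ?case
    using run_Cons.hyps(1) run_Cons.IH run_Cons.prems mono
    by (cases rule: pebble_step.cases) auto
qed simp

lemma pebble_run_append:
  "pebble_run S G c (ms @ ns) c'' \<longleftrightarrow> (\<exists>c'. pebble_run S G c ms c' \<and> pebble_run S G c' ns c'')"
proof (induction ms arbitrary: c)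
  case Nil
  have "pebble_run S G c [] d \<longleftrightarrow> c = d" for d
    by (auto intro: run_Nil elim: pebble_run.cases)
  then show ?case by simp
next
  case (Cons m ms)
  have "pebble_run S G c (m # xs) d \<longleftrightarrow> (\<exists>c'. pebble_step S G c m c' \<and> pebble_run S G c' xs d)"
    for xs d
    by (auto simp: pebble_run.simps[of S G c "m # xs"])
  then show ?case by (auto simp: Cons.IH)
qed

text \<open>\<open>d\<close> is the configuration just before the move \<open>Compute v\<close>. The
  predecessors of \<open>v\<close> are red there, hence white.\<close>

lemma pebble_run_split_before_compute:
  assumes "pebble_run S G c ms c'" "valid_config S G c" "v \<notin> snd c" "v \<in> snd c'"
  shows "\<exists>d ms1 ms2. ms = ms1 @ ms2 \<and> pebble_run S G c ms1 d \<and> pebble_run S G d ms2 c' \<and>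
           v \<notin> snd d \<and> (\<forall>u. (u, v) \<in> edges G \<longrightarrow> u \<in> snd d)"
  using assms
proof (induction rule: pebble_run.induct)
  case (run_Cons c m c' ms c'')
  show ?case
  proof (cases "v \<in> snd c'")
    case True
    with run_Cons.hyps(1) run_Cons.prems
    have "\<forall>u. (u, v) \<in> edges G \<longrightarrow> u \<in> snd c"
      by (cases rule: pebble_step.cases) (auto simp: valid_config_def)
    then show ?thesis
      using run_Cons.prems run_Cons.hyps
      by (metis append_Nil pebble_run.run_Cons pebble_run.run_Nil)
  next
    case False
    with run_Cons.IH run_Cons.prems pebble_step_valid[OF run_Cons.hyps(1)]
    obtain d ms1 ms2 where "ms = ms1 @ ms2" "pebble_run S G c' ms1 d" "pebble_run S G d ms2 c''"
      "v \<notin> snd d" "\<forall>u. (u, v) \<in> edges G \<longrightarrow> u \<in> snd d"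
      by metis
    then show ?thesis
      using run_Cons.hyps(1) by (metis append_Cons pebble_run.run_Cons)
  qed
qed simp

section \<open>Cutting a run by its number of loads\<close>

lemma split_loads:
  "n \<le> loads ms \<Longrightarrow> \<exists>ms1 ms2. ms = ms1 @ ms2 \<and> loads ms1 = n"
proof (induction ms arbitrary: n)
  case (Cons m ms)
  show ?case
  proof (cases "n = 0")
    case True
    then show ?thesis by (metis append_Nil loads_simps(1))
  next
    case False
    define e where "e = (if \<exists>v. m = Load v then 1 else 0 :: nat)"
    have "n - e \<le> loads ms" using Cons.prems by (auto simp: e_def)
    then obtain ms1 ms2 where "ms = ms1 @ ms2" "loads ms1 = n - e"
      using Cons.IH by blast
    moreover have "e \<le> n" using False by (auto simp: e_def)
    ultimately have "m # ms = (m # ms1) @ ms2" "loads (m # ms1) = n"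
      by (auto simp: e_def)
    then show ?thesis by blast
  qed
qed simp

text \<open>Cut a run after every \<open>S\<close> loads; the summand \<open>S\<close> accounts for the last, incomplete segment.\<close>

lemma segment_bound:
  assumes S: "S > 0" and "finite V"
    and segment: "\<And>c ms c'. \<lbrakk>valid_config S G c; pebble_run S G c ms c'; loads ms \<le> S\<rbrakk>
      \<Longrightarrow> a * card (V \<inter> (snd c' - snd c)) \<le> S * b"
    and "valid_config S G c" "pebble_run S G c ms c'"
  shows "a * card (V \<inter> (snd c' - snd c)) \<le> (loads ms + S) * b"
  using assms(4,5)
proof (induction "length ms" arbitrary: c ms rule: less_induct)
  case less
  show ?case
  proof (cases "loads ms \<le> S")
    case True
    with segment[OF less.prems] show ?thesis
      by (metis le_add2 le_trans mult_le_mono1)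
  next
    case False
    then obtain ms1 ms2 where ms: "ms = ms1 @ ms2" "loads ms1 = S"
      using split_loads[of S ms] by auto
    with S have "ms1 \<noteq> []" by auto
    from ms less.prems obtain d where d: "pebble_run S G c ms1 d" "pebble_run S G d ms2 c'"
      by (auto simp: pebble_run_append)
    have "a * card (V \<inter> (snd d - snd c)) \<le> S * b"
      using segment less.prems(1) d(1) ms(2) by simp
    moreover have "a * card (V \<inter> (snd c' - snd d)) \<le> (loads ms2 + S) * b"
      using less.hyps[of ms2 d] d ms \<open>ms1 \<noteq> []\<close> pebble_run_valid[OF d(1) less.prems(1)] by simp
    moreover have "card (V \<inter> (snd c' - snd c))
        \<le> card (V \<inter> (snd d - snd c)) + card (V \<inter> (snd c' - snd d))"
      by (rule order_trans[OF card_mono card_Un_le]) (use \<open>finite V\<close> in auto)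
    then have "a * card (V \<inter> (snd c' - snd c))
        \<le> a * card (V \<inter> (snd d - snd c)) + a * card (V \<inter> (snd c' - snd d))"
      by (metis add_mult_distrib2 mult_le_mono2)
    ultimately show ?thesis
      using ms by (simp add: algebra_simps)
  qed
qed

text \<open>The infimum of a nonempty set of naturals is attained; without a complete game it is
  infinite and the bound is trivial.\<close>

lemma io_complexity_geI:
  assumes "\<And>ms. complete_game S G ms \<Longrightarrow> x \<le> real (loads ms)"
  shows "ereal x \<le> ereal_of_enat (io_complexity S G)"
proof (cases "\<exists>ms. complete_game S G ms")
  case True
  then obtain ms where "complete_game S G ms" by blast
  then have "io_complexity S G \<in> (\<lambda>ms. enat (loads ms)) ` {ms. complete_game S G ms}"
    unfolding io_complexity_def by (intro wellorder_InfI[of "enat (loads ms)"]) auto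
  with assms show ?thesis by auto
next
  case False
  then have "io_complexity S G = \<infinity>"
    by (simp add: io_complexity_def top_enat_def)
  then show ?thesis by simp
qed


section \<open>Dependences of Modified Gram-Schmidt\<close>

text \<open>The execution time of an instance, ordered lexicographically. The instances outside the \<open>j\<close>
  loop get \<open>0\<close> as second component, which is smaller than all \<open>j > k\<close>.\<close>

fun mgs_time :: "mgs_instance \<Rightarrow> nat \<times> nat \<times> nat \<times> nat" where
  "mgs_time (NrmInit k) = (k, 0, 0, 0)"
| "mgs_time (NrmAcc k i) = (k, 0, 1, i)"
| "mgs_time (RDiag k) = (k, 0, 2, 0)"
| "mgs_time (QDiv k i) = (k, 0, 3, i)"
| "mgs_time (RInit k j) = (k, j, 0, 0)"
| "mgs_time (RAcc k j i) = (k, j, 1, i)"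
| "mgs_time (AUpd k j i) = (k, j, 2, i)"

lemma sorted_wrt_concat_map:
  assumes "sorted_wrt P xs" "\<And>x. x \<in> set xs \<Longrightarrow> sorted_wrt R (f x)"
    and "\<And>x y a b. \<lbrakk>x \<in> set xs; y \<in> set xs; P x y; a \<in> set (f x); b \<in> set (f y)\<rbrakk> \<Longrightarrow> R a b"
  shows "sorted_wrt R (concat (map f xs))"
  using assms
proof (induction xs)
  case (Cons x xs)
  have "sorted_wrt R (concat (map f xs))"
  proof (rule Cons.IH)
    show "sorted_wrt P xs" using Cons.prems(1) by simp
    show "sorted_wrt R (f y)" if "y \<in> set xs" for y
      using Cons.prems(2)[of y] that by simp
    show "R a b" if "y \<in> set xs" "z \<in> set xs" "P y z" "a \<in> set (f y)" "b \<in> set (f z)"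
      for y z a b
      using Cons.prems(3)[of y z a b] that by simp
  qed
  moreover have "R a b" if "y \<in> set xs" "a \<in> set (f x)" "b \<in> set (f y)" for a b y
    using Cons.prems(1) Cons.prems(3)[of x y a b] that by auto
  ultimately show ?case using Cons.prems(2)[of x] by (auto simp: sorted_wrt_append)
qed simp

lemma sorted_mgs_trace: "sorted_wrt (\<lambda>s t. mgs_time s < mgs_time t) (mgs_trace M N)"
proof -
  have inner: "sorted_wrt (\<lambda>s t. mgs_time s < mgs_time t)
      (concat (map (\<lambda>j. [RInit k j] @ map (\<lambda>i. RAcc k j i) [0..<M]
        @ map (\<lambda>i. AUpd k j i) [0..<M]) [k+1..<N]))" for k
    by (rule sorted_wrt_concat_map[where P = "(<)"])
       (auto simp: sorted_wrt_append sorted_wrt_map)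
  show ?thesis
    unfolding mgs_trace_def
    by (rule sorted_wrt_concat_map[where P = "(<)"])
       (use inner in \<open>auto simp: sorted_wrt_append sorted_wrt_map\<close>)
qed

lemma mgs_trace_mem [simp]:
  "NrmInit k \<in> set (mgs_trace M N) \<longleftrightarrow> k < N"
  "NrmAcc k i \<in> set (mgs_trace M N) \<longleftrightarrow> k < N \<and> i < M"
  "RDiag k \<in> set (mgs_trace M N) \<longleftrightarrow> k < N"
  "QDiv k i \<in> set (mgs_trace M N) \<longleftrightarrow> k < N \<and> i < M"
  "RInit k j \<in> set (mgs_trace M N) \<longleftrightarrow> k < j \<and> j < N"
  "RAcc k j i \<in> set (mgs_trace M N) \<longleftrightarrow> k < j \<and> j < N \<and> i < M"
  "AUpd k j i \<in> set (mgs_trace M N) \<longleftrightarrow> k < j \<and> j < N \<and> i < M"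
  by (auto simp: mgs_trace_def image_iff bex_disj_distrib)

text \<open>The value of \<open>A[i][j]\<close> at the beginning of iteration \<open>k\<close> of the outer loop.\<close>

definition column :: "nat \<Rightarrow> nat \<Rightarrow> nat \<Rightarrow> (mgs_cell, mgs_instance) node" where
  "column k j i = (if k = 0 then Input (CellA i j) else Inst (AUpd (k - 1) j i))"

section \<open>Edges used in the counting arguments\<close>

lemmas mgs_edge_Inst =
  trace_cdag_edge_Inst[where key = mgs_time and rd = mgs_reads and wr = mgs_write,
    OF sorted_mgs_trace, folded mgs_cdag_def]
lemmas mgs_edge_Input =
  trace_cdag_edge_Input[where key = mgs_time and rd = mgs_reads and wr = mgs_write,
    OF sorted_mgs_trace, folded mgs_cdag_def]

text \<open>Only the instances \<open>AUpd k' j i\<close> with \<open>k' < j\<close> write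
  \<open>A[i][j]\<close>. Thus an instance of iteration \<open>k\<close> sees the write of iteration
  \<open>k - 1\<close>, unless \<open>AUpd k j i\<close> precedes it, which \<open>le\<close>
  excludes.\<close>

lemma mgs_edge_column:
  assumes t: "t \<in> set (mgs_trace M N)" "CellA i j \<in> mgs_reads t" and k: "fst (mgs_time t) = k"
    and kj: "k \<le> j" "j < N" "i < M"
    and le: "k < j \<Longrightarrow> \<not> mgs_time (AUpd k j i) < mgs_time t"
  shows "(column k j i, Inst t) \<in> edges (mgs_cdag M N)"
proof -
  obtain p where time: "mgs_time t = (k, p)"
    using k by (cases "mgs_time t") auto
  have writer: "\<exists>k'<j. u = AUpd k' j i \<and> k' < k"
    if u: "u \<in> set (mgs_trace M N)" "mgs_write u = CellA i j" "mgs_time u < mgs_time t" for u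
  proof -
    obtain k' where k': "u = AUpd k' j i" "k' < j"
      using u(1,2) by (cases u rule: mgs_instance.exhaust) auto
    then have "k' \<le> k" "k' = k \<Longrightarrow> mgs_time (AUpd k j i) < mgs_time t"
      using u(3) time by auto
    then have "k' < k" using le k' by (cases "k' = k") auto
    with k' show ?thesis by blast
  qed
  show ?thesis
  proof (cases k)
    case 0
    have "(Input (CellA i j), Inst t) \<in> edges (mgs_cdag M N)"
      by (rule mgs_edge_Input(1)) (use t writer 0 in blast)+
    with 0 show ?thesis by (simp add: column_def)
  next
    case (Suc l)
    have "(Inst (AUpd l j i), Inst t) \<in> edges (mgs_cdag M N)"
    proof (rule mgs_edge_Inst[where c = "CellA i j"])
      fix u assume u: "u \<in> set (mgs_trace M N)" "mgs_write u = CellA i j"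
        "mgs_time (AUpd l j i) < mgs_time u" "mgs_time u < mgs_time t"
      then obtain k' where "u = AUpd k' j i" "k' < k" using writer by blast
      with u(3) Suc show False by auto
    next
      show "mgs_time (AUpd l j i) < mgs_time t" using time Suc by simp
    qed (use t kj Suc in simp_all)
    with Suc show ?thesis by (simp add: column_def)
  qed
qed

lemma mgs_edges:
  assumes "k < j" "j < N" "i < M"
  shows edge_column_AUpd: "(column k j i, Inst (AUpd k j i)) \<in> edges (mgs_cdag M N)"
    and edge_column_RAcc: "(column k j i, Inst (RAcc k j i)) \<in> edges (mgs_cdag M N)"
    and edge_QDiv_AUpd: "(Inst (QDiv k i), Inst (AUpd k j i)) \<in> edges (mgs_cdag M N)"
    and edge_RAcc_AUpd: "(Inst (RAcc k j (M - 1)), Inst (AUpd k j i)) \<in> edges (mgs_cdag M N)"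
    and edge_RAcc_RAcc: "Suc i < M \<Longrightarrow>
      (Inst (RAcc k j i), Inst (RAcc k j (Suc i))) \<in> edges (mgs_cdag M N)"
proof -
  show "(column k j i, Inst (AUpd k j i)) \<in> edges (mgs_cdag M N)"
    "(column k j i, Inst (RAcc k j i)) \<in> edges (mgs_cdag M N)"
    by (rule mgs_edge_column; use assms in simp)+
  show "(Inst (QDiv k i), Inst (AUpd k j i)) \<in> edges (mgs_cdag M N)"
  proof (rule mgs_edge_Inst[where c = "CellQ i k"])
    fix u assume "u \<in> set (mgs_trace M N)" "mgs_write u = CellQ i k"
      "mgs_time (QDiv k i) < mgs_time u" "mgs_time u < mgs_time (AUpd k j i)"
    then show False by (cases u rule: mgs_instance.exhaust) auto
  qed (use assms in auto)
  show "(Inst (RAcc k j (M - 1)), Inst (AUpd k j i)) \<in> edges (mgs_cdag M N)"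
  proof (rule mgs_edge_Inst[where c = "CellR k j"])
    fix u assume "u \<in> set (mgs_trace M N)" "mgs_write u = CellR k j"
      "mgs_time (RAcc k j (M - 1)) < mgs_time u" "mgs_time u < mgs_time (AUpd k j i)"
    then show False using assms by (cases u rule: mgs_instance.exhaust) auto
  qed (use assms in auto)
  show "(Inst (RAcc k j i), Inst (RAcc k j (Suc i))) \<in> edges (mgs_cdag M N)" if "Suc i < M"
  proof (rule mgs_edge_Inst[where c = "CellR k j"])
    fix u assume "u \<in> set (mgs_trace M N)" "mgs_write u = CellR k j"
      "mgs_time (RAcc k j i) < mgs_time u" "mgs_time u < mgs_time (RAcc k j (Suc i))"
    then show False using assms by (cases u rule: mgs_instance.exhaust) auto
  qed (use assms that in auto)
qed

lemma edge_column_QDiv: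
  assumes "j < N" "i < M"
  shows "(column j j i, Inst (QDiv j i)) \<in> edges (mgs_cdag M N)"
  by (rule mgs_edge_column) (use assms in auto)

lemma mgs_input_edge:
  assumes "j < N" "i < M"
  shows "\<exists>s \<in> set (mgs_trace M N). (Input (CellA i j), Inst s) \<in> edges (mgs_cdag M N)"
proof (cases j)
  case 0
  with edge_column_QDiv[OF assms] assms show ?thesis
    by (intro bexI[of _ "QDiv j i"]) (auto simp: column_def)
next
  case (Suc l)
  with edge_column_AUpd[of 0 j N i M] assms show ?thesis
    by (intro bexI[of _ "AUpd 0 j i"]) (auto simp: column_def)
qed

lemma mgs_input:
  assumes "j < N" "i < M"
  shows "Input (CellA i j) \<in> inputs (mgs_cdag M N)"
proof -
  obtain s where "s \<in> set (mgs_trace M N)"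
    "(Input (CellA i j), Inst s) \<in> edges (mgs_cdag M N)"
    using mgs_input_edge[OF assms] by blast
  then obtain p c where p: "producer mgs_write (mgs_trace M N) p c = Input (CellA i j)"
    "p < length (mgs_trace M N)" "c \<in> mgs_reads (mgs_trace M N ! p)"
    unfolding mgs_cdag_def trace_cdag_def by auto
  \<comment> \<open>\<open>producer\<close> yields an \<open>Input\<close> node only for a cell
    without earlier writes, so the edge itself certifies the input.\<close>
  from p(1) have "earlier_writes mgs_write (mgs_trace M N) p c = {}" "c = CellA i j"
    by (simp_all add: producer_def split: if_splits)
  with p(2,3) show ?thesis
    unfolding mgs_cdag_def trace_cdag_def trace_inputs_def by auto
qed

text \<open>The hourglass: everything in column \<open>j\<close> before iteration \<open>k\<close> passes through \<open>R[k][j]\<close>, on which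
  everything in column \<open>j\<close> from iteration \<open>k\<close> on depends.\<close>

lemma RAcc_column_mem:
  assumes "downclosed (mgs_cdag M N) W" "k < j" "j < N"
  shows "n < M \<Longrightarrow> Inst (RAcc k j n) \<in> W \<Longrightarrow> i \<le> n \<Longrightarrow> column k j i \<in> W"
proof (induction n)
  case 0
  then show ?case
    by (intro downclosedD[OF assms(1) edge_column_RAcc[OF assms(2,3)]]) simp_all
next
  case (Suc n)
  show ?case
  proof (cases "i = Suc n")
    case True
    with Suc.prems show ?thesis
      by (intro downclosedD[OF assms(1) edge_column_RAcc[OF assms(2,3)]]) simp_all
  next
    case False
    have "Inst (RAcc k j n) \<in> W"
      by (rule downclosedD[OF assms(1) edge_RAcc_RAcc[OF assms(2,3)]]) (use Suc.prems in simp_all)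
    then show ?thesis using Suc False by simp
  qed
qed

lemma AUpd_down:
  assumes "downclosed (mgs_cdag M N) W" "j < N" "i < M"
  shows "k \<le> l \<Longrightarrow> l < j \<Longrightarrow> Inst (AUpd l j i) \<in> W \<Longrightarrow> Inst (AUpd k j i) \<in> W"
proof (induction rule: dec_induct)
  case (step l)
  have "column (Suc l) j i \<in> W"
    using step.prems by (intro downclosedD[OF assms(1) edge_column_AUpd]) (use assms in auto)
  then show ?case using step by (simp add: column_def)
qed

text \<open>Go back from \<open>AUpd l j i\<close> to the last \<open>RAcc l j\<close>, along the
  accumulation chain to row \<open>i'\<close>, and through the versions of that entry to iteration
  \<open>k\<close>. By \<open>k < l\<close>, \<open>column l j i'\<close> is an update, that of
  iteration \<open>l - 1\<close>.\<close>

lemma hourglass: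
  assumes W: "downclosed (mgs_cdag M N) W" and "k < l" "l < j" "j < N" "i < M" "i' < M"
    and "Inst (AUpd l j i) \<in> W"
  shows "Inst (AUpd k j i') \<in> W"
proof -
  have "Inst (RAcc l j (M - 1)) \<in> W"
    by (rule downclosedD[OF W edge_RAcc_AUpd]) (use assms in simp_all)
  then have "column l j i' \<in> W"
    using RAcc_column_mem[OF W, where n = "M - 1" and i = i'] assms by simp
  then have "Inst (AUpd (l - 1) j i') \<in> W"
    using assms by (simp add: column_def)
  then show ?thesis
    using AUpd_down[OF W, of j i' k "l - 1"] assms by simp
qed


section \<open>Updates within a segment\<close>

definition upd_index :: "nat \<Rightarrow> nat \<Rightarrow> (nat \<times> nat \<times> nat) set" where
  "upd_index M N = {(k, j, i). k < j \<and> j < N \<and> i < M}"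

definition upd_node :: "nat \<times> nat \<times> nat \<Rightarrow> (mgs_cell, mgs_instance) node" where
  "upd_node = (\<lambda>(k, j, i). Inst (AUpd k j i))"

lemma inj_upd_node: "inj upd_node"
  by (auto simp: inj_def upd_node_def)

section \<open>Counting the updates\<close>

lemma card_pairs_less: "2 * card {(k, j). k < j \<and> j < N} = N * (N - 1 :: nat)"
proof -
  have "{(k, j). k < j \<and> j < N} = prod.swap ` (SIGMA j:{..<N}. {..<j})"
    by (auto simp: image_iff)
  then have "card {(k, j). k < j \<and> j < N} = (\<Sum>j<N. j)"
    by (simp add: card_image)
  moreover have "even (N * (N - 1))" by (cases N) auto
  ultimately show ?thesis
    by (simp add: Sum_Ico_nat atLeast0LessThan[symmetric])
qed

lemma finite_pairs_less: "finite {(k, j). k < j \<and> j < (N :: nat)}"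
  by (rule finite_subset[of _ "{..<N} \<times> {..<N}"]) auto

lemma upd_index_eq: "upd_index M N =
    (\<lambda>((k, j), i). (k, j, i)) ` ({(k, j). k < j \<and> j < N} \<times> {..<M})"
  by (auto simp: upd_index_def image_iff)

lemma finite_upd_index: "finite (upd_index M N)"
  by (simp add: upd_index_eq finite_pairs_less)

lemma card_upd_index: "2 * card (upd_index M N) = M * (N * (N - 1))"
proof -
  have "card (upd_index M N) = card {(k, j). k < j \<and> j < N} * M"
    unfolding upd_index_eq by (subst card_image) (auto simp: inj_on_def card_cartesian_product)
  then show ?thesis using card_pairs_less[of N] by (simp add: algebra_simps)
qed

text \<open>\<open>Q[i][j]\<close> is regarded as the last version of \<open>A[i][j]\<close>; the value on other nodes is irrelevant.\<close>

fun matrix_entry :: "(mgs_cell, mgs_instance) node \<Rightarrow> nat \<times> nat" where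
  "matrix_entry (Input (CellA i j)) = (i, j)"
| "matrix_entry (Inst (AUpd k j i)) = (i, j)"
| "matrix_entry (Inst (QDiv j i)) = (i, j)"
| "matrix_entry _ = (0, 0)"

lemma matrix_entry_column: "matrix_entry (column k j i) = (i, j)"
  by (simp add: column_def)

text \<open>The increasing pairs and their mirror images are disjoint subsets of
  \<open>F \<times> F\<close>.\<close>

lemma card_pairs_less_le:
  fixes F :: "'a::linorder set"
  assumes "finite F"
  shows "2 * card {(k, j). k \<in> F \<and> j \<in> F \<and> k < j} \<le> card F * card F"
proof -
  let ?P = "{(k, j). k \<in> F \<and> j \<in> F \<and> k < j}"
  have fin: "finite ?P"
    by (rule finite_subset[of _ "F \<times> F"]) (use assms in auto)
  have "card (prod.swap ` ?P) = card ?P"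
    by (simp add: card_image)
  then have "2 * card ?P = card (?P \<union> prod.swap ` ?P)"
    using fin by (subst card_Un_disjoint) auto
  also have "\<dots> \<le> card (F \<times> F)"
    by (rule card_mono) (use assms in auto)
  finally show ?thesis by (simp add: card_cartesian_product)
qed

text \<open>\<open>W\<close> and \<open>W'\<close> are the white sets before and after a segment,
  \<open>D\<close> the values it obtains from outside, \<open>E\<close> the updates it
  computes.\<close>

lemma updates_in_segment:
  fixes M N W W' D
  defines "E \<equiv> {x \<in> upd_index M N. upd_node x \<in> W' - W}"
  assumes M: "M > 0" and closed: "downclosed (mgs_cdag M N) W" "downclosed (mgs_cdag M N) W'"
    and inp: "inputs (mgs_cdag M N) \<subseteq> W" and D: "finite D"
    and pred: "\<And>u v. \<lbrakk>(u, v) \<in> edges (mgs_cdag M N); v \<in> W' - W\<rbrakk> \<Longrightarrow> u \<in> D \<union> (W' - W)"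
  shows "2 * M * card E \<le> card D * (card D + 4 * M)"
proof -
  define X where "X = matrix_entry ` D"
  have finX: "finite X" and cardX: "card X \<le> card D"
    using D by (auto simp: X_def card_image_le)
  have E_iff: "(k, j, i) \<in> E \<longleftrightarrow> k < j \<and> j < N \<and> i < M \<and> Inst (AUpd k j i) \<in> W' - W" for k j i
    by (auto simp: E_def upd_index_def upd_node_def)
  have finE: "finite E"
    using finite_upd_index by (auto simp: E_def)

  \<comment> \<open>Going back through the versions of an entry must leave \<open>W' - W\<close>,
    since version \<open>0\<close> is an input and lies in \<open>W\<close>. The first version
    outside lies in \<open>D\<close>.\<close>
  have X_column: "(i, j) \<in> X" if "column k j i \<in> D \<union> (W' - W)" "k \<le> j" "j < N" "i < M" for k j i
    using that
  proof (induction k)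
    case 0
    have "column 0 j i \<in> W" using mgs_input inp 0 by (auto simp: column_def)
    with 0 have "column 0 j i \<in> D" by auto
    then show ?case unfolding X_def by (metis image_eqI matrix_entry_column)
  next
    case (Suc k)
    show ?case
    proof (cases "column (Suc k) j i \<in> D")
      case True
      then show ?thesis unfolding X_def by (metis image_eqI matrix_entry_column)
    next
      case False
      with Suc.prems have "Inst (AUpd k j i) \<in> W' - W" by (simp add: column_def)
      then show ?thesis using Suc pred[OF edge_column_AUpd] by auto
    qed
  qed
  have X_Q: "(i, j) \<in> X" if "Inst (QDiv j i) \<in> D \<union> (W' - W)" "j < N" "i < M" for j i
  proof (cases "Inst (QDiv j i) \<in> D")
    case True
    then show ?thesis unfolding X_def by (metis image_eqI matrix_entry.simps(3))
  next
    case False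
    then have "column j j i \<in> D \<union> (W' - W)"
      using that pred[OF edge_column_QDiv] by auto
    then show ?thesis using X_column that by auto
  qed
  have X_E: "(i, j) \<in> X \<and> (i, k) \<in> X" if "(k, j, i) \<in> E" for k j i
  proof -
    have *: "k < j" "j < N" "i < M" "Inst (AUpd k j i) \<in> W' - W" using that by (auto simp: E_iff)
    then show ?thesis
      using X_column[OF pred[OF edge_column_AUpd]] X_Q[OF pred[OF edge_QDiv_AUpd]] by auto
  qed

  \<comment> \<open>For fixed \<open>j\<close>, all elements of \<open>first\<close> share the same
    \<open>k\<close>, so \<open>(i, j)\<close> determines them; likewise for
    \<open>last\<close>.\<close>
  define first where "first = {(k, j, i) \<in> E. \<forall>k' i'. (k', j, i') \<in> E \<longrightarrow> k \<le> k'}"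
  define last where "last = {(k, j, i) \<in> E. \<forall>k' i'. (k', j, i') \<in> E \<longrightarrow> k' \<le> k}"
  define middle where "middle = E - first - last"
  have "card first \<le> card X"
  proof (rule card_inj_on_le[where f = "\<lambda>(k, j, i). (i, j)"])
    show "inj_on (\<lambda>(k, j, i). (i, j)) first"
      by (auto simp: inj_on_def first_def intro: order_antisym)
  qed (use X_E finX in \<open>auto simp: first_def\<close>)
  moreover have "card last \<le> card X"
  proof (rule card_inj_on_le[where f = "\<lambda>(k, j, i). (i, j)"])
    show "inj_on (\<lambda>(k, j, i). (i, j)) last"
      by (auto simp: inj_on_def last_def intro: order_antisym)
  qed (use X_E finX in \<open>auto simp: last_def\<close>)
  moreover have "E \<subseteq> first \<union> last \<union> middle" by (auto simp: middle_def)
  then have "card E \<le> card (first \<union> last \<union> middle)"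
    by (rule card_mono[rotated])
      (use finE in \<open>auto simp: first_def last_def middle_def intro: finite_subset\<close>)
  then have "card E \<le> card first + card last + card middle"
    using card_Un_le[of "first \<union> last" middle] card_Un_le[of first last] by linarith
  ultimately have E_le: "card E \<le> 2 * card X + card middle" by linarith

  \<comment> \<open>The entirely touched columns; each takes up \<open>M\<close> positions of
    \<open>X\<close>.\<close>
  define F where "F = {j. \<forall>i<M. (i, j) \<in> X}"
  have F_sub: "{..<M} \<times> F \<subseteq> X" by (auto simp: F_def)
  have "F \<subseteq> snd ` X" using M by (force simp: F_def)
  then have finF: "finite F" using finX by (auto intro: finite_subset)
  have cardF: "M * card F \<le> card X"
    using card_mono[OF finX F_sub] by (simp add: card_cartesian_product)

  have full: "k \<in> F \<and> j \<in> F \<and> k < j \<and> i < M" if "(k, j, i) \<in> middle" for k j i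
  proof -
    from that have kji: "(k, j, i) \<in> E" by (simp add: middle_def)
    with that obtain k1 i1 k2 i2 where *: "(k1, j, i1) \<in> E" "k1 < k" "(k2, j, i2) \<in> E" "k < k2"
      by (auto simp: middle_def first_def last_def not_le)
    \<comment> \<open>The hourglass is used twice: if \<open>AUpd k j i'\<close> were in
      \<open>W\<close>, so would be the earlier update at \<open>k1\<close>; the later update at
      \<open>k2\<close> forces it into \<open>W'\<close>.\<close>
    have "(k, j, i') \<in> E" if "i' < M" for i'
    proof -
      have "Inst (AUpd k j i') \<notin> W"
        using hourglass[OF closed(1), of k1 k j i' i1] * kji that by (auto simp: E_iff)
      moreover have "Inst (AUpd k j i') \<in> W'"
        using hourglass[OF closed(2), of k k2 j i2 i'] * kji that by (auto simp: E_iff)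
      ultimately show ?thesis using kji that by (auto simp: E_iff)
    qed
    then show ?thesis using X_E kji by (auto simp: F_def E_iff)
  qed
  let ?P = "{(k, j). k \<in> F \<and> j \<in> F \<and> k < j}"
  have "finite ?P" by (rule finite_subset[of _ "F \<times> F"]) (use finF in auto)
  then have "card middle \<le> card (?P \<times> {..<M})"
    using full
    by (intro card_inj_on_le[where f = "\<lambda>(k, j, i). ((k, j), i)"]) (auto simp: inj_on_def)
  then have "2 * card middle \<le> 2 * card ?P * M"
    by (simp add: card_cartesian_product)
  also have "\<dots> \<le> card F * card F * M"
    by (rule mult_le_mono1[OF card_pairs_less_le[OF finF]])
  finally have "2 * card middle \<le> card F * card F * M" .
  \<comment> \<open>The extra factor \<open>M\<close> gives each \<open>card F\<close> its own
    \<open>M\<close>, so that \<open>M * card F \<le> card X\<close> applies twice without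
    division.\<close>
  then have "2 * M * card middle \<le> (M * card F) * (M * card F)"
    using mult_le_mono2[of "2 * card middle" "card F * card F * M" M] by (simp add: algebra_simps)
  also have "\<dots> \<le> card X * card X" using cardF by (intro mult_le_mono)
  finally have "2 * M * card E \<le> 4 * M * card X + card X * card X"
    using mult_le_mono2[OF E_le, of "2 * M"] by (simp add: algebra_simps)
  also have "\<dots> \<le> 4 * M * card D + card D * card D"
    using cardX by (intro add_mono mult_le_mono) auto
  finally show ?thesis by (simp add: algebra_simps)
qed


section \<open>Lower bounds on the number of loads\<close>

lemma complete_game_run:
  assumes "complete_game S (mgs_cdag M N) ms"
  obtains c where "pebble_run S (mgs_cdag M N) ({}, inputs (mgs_cdag M N)) ms c"
    "Inst ` set (mgs_trace M N) \<subseteq> snd c"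
  using assms by (auto simp: complete_game_def mgs_cdag_def trace_cdag_def)

lemma valid_initial: "valid_config S (mgs_cdag M N) ({}, inputs (mgs_cdag M N))"
  by (auto simp: valid_config_def downclosed_def mgs_cdag_def dest: inputs_no_pred)

text \<open>Every matrix input is read by some instance, but is white from the start and so never
  computed; it can turn red only by a load.\<close>

lemma loads_ge_inputs:
  assumes "complete_game S (mgs_cdag M N) ms"
  shows "M * N \<le> loads ms"
proof -
  let ?G = "mgs_cdag M N"
  obtain c where run: "pebble_run S ?G ({}, inputs ?G) ms c"
    and compl: "Inst ` set (mgs_trace M N) \<subseteq> snd c"
    using assms by (rule complete_game_run)
  have "Input (CellA i j) \<in> loaded ms" if ij: "i < M" "j < N" for i j
  proof -
    obtain s where "s \<in> set (mgs_trace M N)" "(Input (CellA i j), Inst s) \<in> edges ?G"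
      using mgs_input_edge ij by blast
    moreover have "Inst s \<notin> inputs ?G" by (simp add: mgs_cdag_def Inst_notin_inputs)
    ultimately show ?thesis
      using pebble_run_pred[OF run, of "Input (CellA i j)" "Inst s"] compl mgs_input ij by auto
  qed
  then have "card ({..<M} \<times> {..<N}) \<le> card (loaded ms)"
    by (intro card_inj_on_le[where f = "\<lambda>(i, j). Input (CellA i j)"])
      (auto simp: inj_on_def finite_loaded)
  then show ?thesis using card_loaded_le[of ms] by (simp add: card_cartesian_product)
qed

lemma loads_ge_updates:
  assumes "complete_game S (mgs_cdag M N) ms" "M > 0" "S > 0"
  shows "M * M * (N * (N - 1)) \<le> 4 * (loads ms + S) * (S + 2 * M)"
proof -
  let ?G = "mgs_cdag M N" and ?V = "upd_node ` upd_index M N"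
  obtain c where run: "pebble_run S ?G ({}, inputs ?G) ms c"
    and compl: "Inst ` set (mgs_trace M N) \<subseteq> snd c"
    using assms(1) by (rule complete_game_run)
  have segment: "2 * M * card (?V \<inter> (snd c' - snd c)) \<le> S * (4 * (S + 2 * M))"
    if c: "valid_config S ?G c" "pebble_run S ?G c ms c'" "loads ms \<le> S" for c ms c'
  proof -
    define D where "D = fst c \<union> loaded ms"
    define E where "E = {x \<in> upd_index M N. upd_node x \<in> snd c' - snd c}"
    have c': "valid_config S ?G c'" using c pebble_run_valid by blast
    have "finite D" using c(1) finite_loaded by (auto simp: D_def valid_config_def)
    then have "2 * M * card E \<le> card D * (card D + 4 * M)"
      unfolding E_def using c c' pebble_run_pred[OF c(2)]
      by (intro updates_in_segment \<open>M > 0\<close>) (auto simp: D_def valid_config_def)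
    \<comment> \<open>At most \<open>S\<close> nodes are red at the start and at most
      \<open>S\<close> are loaded. The result is \<open>segment_bound\<close> with
      \<open>a = 2 * M\<close> and \<open>b = 4 * (S + 2 * M)\<close>.\<close>
    also have "card D \<le> 2 * S"
      using card_Un_le[of "fst c" "loaded ms"] card_loaded_le[of ms] c
      by (auto simp: D_def valid_config_def)
    then have "card D * (card D + 4 * M) \<le> 2 * S * (2 * S + 4 * M)"
      by (intro mult_le_mono) auto
    finally have "2 * M * card E \<le> S * (4 * (S + 2 * M))" by (simp add: algebra_simps)
    moreover have "?V \<inter> (snd c' - snd c) = upd_node ` E" by (auto simp: E_def)
    ultimately show ?thesis
      by (simp add: card_image inj_on_subset[OF inj_upd_node])
  qed
  have "finite ?V" by (simp add: finite_upd_index)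
  from segment_bound[OF \<open>S > 0\<close> this segment valid_initial run]
  have "2 * M * card (?V \<inter> (snd c - inputs ?G)) \<le> (loads ms + S) * (4 * (S + 2 * M))" by simp
  moreover have "?V \<subseteq> snd c - inputs ?G"
    using compl by (auto simp: upd_index_def upd_node_def mgs_cdag_def Inst_notin_inputs)
  then have "?V \<inter> (snd c - inputs ?G) = ?V" by blast
  ultimately have "2 * M * card (upd_index M N) \<le> (loads ms + S) * (4 * (S + 2 * M))"
    by (simp add: card_image inj_on_subset[OF inj_upd_node])
  then show ?thesis using card_upd_index[of M N] by (simp add: algebra_simps)
qed

text \<open>When the last \<open>RAcc k j\<close> is about to be computed, column \<open>j\<close> has already been computed and is still
  needed by the updates, but at most \<open>S\<close> of its \<open>M\<close> entries are red.\<close>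

lemma loads_column:
  assumes "complete_game S (mgs_cdag M N) ms" "k < j" "j < N"
  shows "M - S \<le> card {i. i < M \<and> column k j i \<in> loaded ms}"
proof (cases "M = 0")
  case False
  let ?G = "mgs_cdag M N" and ?r = "Inst (RAcc k j (M - 1))"
  obtain c where run: "pebble_run S ?G ({}, inputs ?G) ms c"
    and compl: "Inst ` set (mgs_trace M N) \<subseteq> snd c"
    using assms(1) by (rule complete_game_run)
  have "?r \<notin> snd ({}, inputs ?G)" by (simp add: mgs_cdag_def Inst_notin_inputs)
  moreover have "?r \<in> snd c" using compl assms False by auto
  ultimately obtain d ms1 ms2 where ms: "ms = ms1 @ ms2"
    and d: "pebble_run S ?G ({}, inputs ?G) ms1 d" "pebble_run S ?G d ms2 c"
    and r: "?r \<notin> snd d" and preds: "\<And>u. (u, ?r) \<in> edges ?G \<Longrightarrow> u \<in> snd d"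
    using pebble_run_split_before_compute[OF run valid_initial] by blast
  have valid: "valid_config S ?G d" using pebble_run_valid d(1) valid_initial by blast
  then have closed: "downclosed ?G (snd d)" by (simp add: valid_config_def)
  \<comment> \<open>Since \<open>?r\<close> itself is not yet white, its own row
    \<open>M - 1\<close> is reached as a direct predecessor, the other rows through the preceding
    \<open>RAcc\<close>.\<close>
  have col: "column k j i \<in> snd d" if iM: "i < M" for i
  proof (cases "i = M - 1")
    case True
    then show ?thesis using preds edge_column_RAcc assms that by auto
  next
    case False
    then obtain n where n: "M - 1 = Suc n" "i \<le> n" using iM by (cases "M - 1") auto
    then have "Inst (RAcc k j n) \<in> snd d"
      using preds edge_RAcc_RAcc[of k j N n M] assms by auto
    then show ?thesis using RAcc_column_mem[OF closed, of k j n i] assms n by auto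
  qed
  \<comment> \<open>No update of column \<open>j\<close> in iteration \<open>k\<close> can precede
    \<open>?r\<close>, so each is computed after \<open>d\<close>. Its column entry is white at
    \<open>d\<close>, hence red at \<open>d\<close> or loaded later.\<close>
  have "column k j i \<in> fst d \<union> loaded ms" if "i < M" for i
  proof -
    have "Inst (AUpd k j i) \<notin> snd d"
      using downclosedD[OF closed edge_RAcc_AUpd] r assms that by blast
    moreover have "Inst (AUpd k j i) \<in> snd c" using compl assms that by auto
    ultimately show ?thesis
      using pebble_run_pred[OF d(2) edge_column_AUpd, of k j i] col that assms ms by auto
  qed
  then have "{..<M} \<subseteq> {i. i < M \<and> column k j i \<in> loaded ms} \<union> {i. column k j i \<in> fst d}"
    (is "_ \<subseteq> ?L \<union> ?R") by auto
  moreover have inj: "inj (column k j)" by (auto simp: inj_def column_def)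
  have fin: "finite (fst d)" and "card (fst d) \<le> S" using valid by (auto simp: valid_config_def)
  have "column k j ` ?R \<subseteq> fst d" by auto
  then have "card ?R \<le> S"
    using card_inj_on_le[of "column k j" ?R "fst d"] inj_on_subset[OF inj, of ?R] fin
      \<open>card (fst d) \<le> S\<close> by auto
  moreover have "finite ?R"
    using finite_vimageI[OF fin inj] by (simp add: vimage_def)
  ultimately have "M \<le> card ?L + card ?R"
    using card_mono[of "?L \<union> ?R" "{..<M}"] card_Un_le[of ?L ?R] by auto
  then show ?thesis using \<open>card ?R \<le> S\<close> by linarith
qed simp

text \<open>Different triples \<open>(k, j, i)\<close> give different nodes
  \<open>column k j i\<close>, so the loads counted for different pairs \<open>(k, j)\<close> add
  up.\<close>

lemma loads_ge_columns:
  assumes "complete_game S (mgs_cdag M N) ms"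
  shows "(M - S) * (N * (N - 1)) \<le> 2 * loads ms"
proof -
  let ?P = "{(k, j). k < j \<and> j < N}"
  define L where "L = (SIGMA p:?P. {i. i < M \<and> column (fst p) (snd p) i \<in> loaded ms})"
  have "(M - S) * card ?P = (\<Sum>p\<in>?P. M - S)" by simp
  also have "\<dots> \<le> (\<Sum>p\<in>?P. card {i. i < M \<and> column (fst p) (snd p) i \<in> loaded ms})"
    by (rule sum_mono) (use loads_column[OF assms] in auto)
  also have "\<dots> = card L"
    unfolding L_def using finite_pairs_less by (subst card_SigmaI) auto
  also have "card L \<le> card (loaded ms)"
  proof (rule card_inj_on_le[where f = "\<lambda>((k, j), i). column k j i"])
    show "inj_on (\<lambda>((k, j), i). column k j i) L"
      by (auto simp: inj_on_def column_def split: if_splits)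
  qed (auto simp: L_def finite_loaded)
  also have "\<dots> \<le> loads ms" by (rule card_loaded_le)
  finally show ?thesis using card_pairs_less[of N]
    by (metis (no_types, lifting) mult.left_commute mult_le_mono2)
qed

text \<open>If \<open>Q \<ge> S + 2 * M\<close>, the excess \<open>4 * S * (S + 2 * M)\<close> in
  \<open>upd\<close> is at most \<open>4 * S * Q\<close>. Otherwise
  \<open>M * N \<le> Q < S + 2 * M\<close> gives \<open>M * (N - 1) < S + M\<close>, and multiplying
  by \<open>M * N \<le> Q\<close> suffices.\<close>

lemma combine_bounds:
  fixes M N S Q :: real
  assumes "M > 0" "S > 0" "N \<ge> 1" and Q: "M * N \<le> Q"
    and upd: "M * M * (N * (N - 1)) \<le> 4 * (Q + S) * (S + 2 * M)"
  shows "M * M * (N * (N - 1)) \<le> 8 * (S + M) * Q"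
proof (cases "Q < S + 2 * M")
  case True
  have *: "M * (N - 1) \<le> 8 * (S + M)"
    using Q True assms by (simp add: algebra_simps)
  have "0 \<le> Q" using order_trans[OF _ Q, of 0] assms by simp
  then have "(M * N) * (M * (N - 1)) \<le> Q * (8 * (S + M))"
    by (rule mult_mono[OF Q *]) (use assms in simp)
  then show ?thesis by (simp add: algebra_simps)
next
  case False
  then have "S * (S + 2 * M) \<le> S * Q" using assms by (intro mult_left_mono) auto
  then show ?thesis using upd by (simp add: algebra_simps)
qed

theorem theorem3:
  fixes M N S :: nat
  assumes "M > 0" and "N > 0" and "S > 0"
  shows "ereal ((real M)\<^sup>2 * real N * (real N - 1) / (8 * (real S + real M)))
           \<le> ereal_of_enat (io_complexity S (mgs_cdag M N))
       \<and> (S \<le> M \<longrightarrow>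
           ereal ((real M - real S) * real N * (real N - 1) / 4)
           \<le> ereal_of_enat (io_complexity S (mgs_cdag M N)))"
proof (intro conjI impI io_complexity_geI)
  fix ms assume game: "complete_game S (mgs_cdag M N) ms"
  have "real (M * M * (N * (N - 1))) \<le> real (4 * (loads ms + S) * (S + 2 * M))"
    using loads_ge_updates[OF game] assms by (intro of_nat_mono) auto
  then have "real M * real M * (real N * (real N - 1))
      \<le> 4 * (real (loads ms) + real S) * (real S + 2 * real M)"
    using \<open>N > 0\<close> by (simp add: of_nat_diff)
  moreover have "real M * real N \<le> real (loads ms)"
    using loads_ge_inputs[OF game] by (metis of_nat_le_iff of_nat_mult)
  ultimately have "real M * real M * (real N * (real N - 1)) \<le> 8 * (real S + real M) * real (loads ms)"
    using assms by (intro combine_bounds) auto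
  then show "(real M)\<^sup>2 * real N * (real N - 1) / (8 * (real S + real M)) \<le> real (loads ms)"
    using assms by (simp add: divide_le_eq power2_eq_square algebra_simps)
next
  fix ms assume game: "complete_game S (mgs_cdag M N) ms" and "S \<le> M"
  have "real ((M - S) * (N * (N - 1))) \<le> real (2 * loads ms)"
    using loads_ge_columns[OF game] by (intro of_nat_mono)
  then have "(real M - real S) * (real N * (real N - 1)) \<le> 2 * real (loads ms)"
    using \<open>N > 0\<close> \<open>S \<le> M\<close> by (simp add: of_nat_diff)
  then show "(real M - real S) * real N * (real N - 1) / 4 \<le> real (loads ms)"
    by (simp add: algebra_simps)
qed

end
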